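(* Let $h,n$ be positive integers. (i) If $C=\{0,c_1,\ldots,c_n\}$ is an $h$-basis for a finite Abelian group $G$, then $(\triangle^n_h,\mathcal{L})$ is a covering of $\mathbb{Z}^n$, where \[ \mathcal{L}=\Big\{\mathbf{x}\in\mathbb{Z}^n : \sum_{i=1}^n x_i c_i=0\Big\}, \] and $G$ is isomorphic to $\mathbb{Z}^n/\mathcal{L}$. (ii) Conversely, if $(\triangle^n_h,\mathcal{L}')$ is a lattice covering of $\mathbb{Z}^n$, then the group $\mathbb{Z}^n/\mathcal{L}'$ contains an $h$-basis of cardinality at most $n+1$.
   Context: A subset $C=\{c_0,c_1,\ldots,c_n\}$ of a finite additive Abelian group $G$ is an $h$-basis (basis of order $h$) of $G$ if every element of $G$ can be expressed as $c_{i_1}+\cdots+c_{i_h}$ for some $0\leq i_1\leq\cdots\leq i_h\leq n$. A group "contains an $h$-basis" means that it has a subset which is an $h$-basis of that group. The discrete simplex: $\triangle^n_h=\{\mathbf{x}\in\mathbb{Z}^n : x_i\geq 0 \text{ for all } i,\ \sum_{i=1}^n x_i\leq h\}$. For a finite set $S\subset\mathbb{Z}^n$ and a (full-rank) sublattice $\mathcal{L}\subseteq\mathbb{Z}^n$, $(S,\mathcal{L})$ is a (lattice) covering of $\mathbb{Z}^n$ if $\bigcup_{\mathbf{x}\in\mathcal{L}}(S+\mathbf{x})=\mathbb{Z}^n$. *)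

theory Defs
  imports "HOL-Algebra.Algebra"
begin

text \<open>
  Finite Abelian groups, written additively in the source, are multiplicative
  \<^locale>\<open>comm_group\<close>s here: sums become products and integer multiples become integer powers.
\<close>

text \<open>
  The enumeration \<open>c\<close> may have repetitions; whether \<open>C\<close> is an \<open>h\<close>-basis does not depend on
  the enumeration chosen.
\<close>

definition h_basis :: "('a, 'b) monoid_scheme \<Rightarrow> nat \<Rightarrow> 'a set \<Rightarrow> bool" where
  "h_basis G h C \<longleftrightarrow>
     comm_group G \<and> finite (carrier G) \<and> C \<subseteq> carrier G \<and>
     (\<exists>(m::nat) (c :: nat \<Rightarrow> 'a). C = c ` {0..m} \<and>
        (\<forall>g\<in>carrier G. \<exists>i :: nat \<Rightarrow> nat.
           i \<in> {1..h} \<rightarrow> {0..m} \<and> mono_on {1..h} i \<and>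
           g = (\<Otimes>\<^bsub>G\<^esub>j\<in>{1..h}. c (i j))))"

text \<open>
  The additive group \<open>\<int>\<^sup>n\<close>. Its elements are functions on \<open>{1..n}\<close> (extended by
  \<^const>\<open>undefined\<close>), and its operation is coordinatewise addition.
\<close>

definition Zn :: "nat \<Rightarrow> (nat \<Rightarrow> int) monoid" where
  "Zn n = product_group {1..n} (\<lambda>_. integer_group)"

definition discrete_simplex :: "nat \<Rightarrow> nat \<Rightarrow> (nat \<Rightarrow> int) set" where
  "discrete_simplex n h =
     {x \<in> carrier (Zn n). (\<forall>i\<in>{1..n}. 0 \<le> x i) \<and> (\<Sum>i=1..n. x i) \<le> int h}"

text \<open>
  Full rank: the subgroup contains \<open>n\<close> vectors that are linearly independent over \<open>\<int>\<close>
  (equivalently, over \<open>\<real>\<close>).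
\<close>

definition full_rank_sublattice :: "nat \<Rightarrow> (nat \<Rightarrow> int) set \<Rightarrow> bool" where
  "full_rank_sublattice n L \<longleftrightarrow>
     subgroup L (Zn n) \<and>
     (\<exists>b :: nat \<Rightarrow> nat \<Rightarrow> int. (\<forall>j\<in>{1..n}. b j \<in> L) \<and>
        (\<forall>a :: nat \<Rightarrow> int. (\<forall>i\<in>{1..n}. (\<Sum>j=1..n. a j * b j i) = 0) \<longrightarrow>
           (\<forall>j\<in>{1..n}. a j = 0)))"

text \<open>In \<^term>\<open>Zn n\<close> the coset notation \<open>S #> x\<close> is the translate \<open>S + x\<close> of an arbitrary set \<open>S\<close>.\<close>

definition lattice_covering ::
    "nat \<Rightarrow> (nat \<Rightarrow> int) set \<Rightarrow> (nat \<Rightarrow> int) set \<Rightarrow> bool" where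
  "lattice_covering n S L \<longleftrightarrow>
     finite S \<and> S \<subseteq> carrier (Zn n) \<and> full_rank_sublattice n L \<and>
     (\<Union>x\<in>L. S #>\<^bsub>Zn n\<^esub> x) = carrier (Zn n)"

definition relation_lattice ::
    "('a, 'b) monoid_scheme \<Rightarrow> nat \<Rightarrow> (nat \<Rightarrow> 'a) \<Rightarrow> (nat \<Rightarrow> int) set" where
  "relation_lattice G n c =
     {x \<in> carrier (Zn n). (\<Otimes>\<^bsub>G\<^esub>i\<in>{1..n}. c i [^]\<^bsub>G\<^esub> x i) = \<one>\<^bsub>G\<^esub>}"

end

theory Submission
  imports Defs "HOL-Combinatorics.Permutations"
begin

text \<open>
  Let \<open>e\<^sub>1, \<dots>, e\<^sub>n\<close> be the unit vectors of \<open>\<int>\<^sup>n\<close> and \<open>e\<^sub>0 = 0\<close>. The simplex of size \<open>h\<close> is exactly the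
  \<open>h\<close>-fold sumset of \<open>{e\<^sub>0, \<dots>, e\<^sub>n}\<close> (\<open>discrete_simplex_eq_sumset\<close>): a vector with nonnegative
  entries of sum at most \<open>h\<close> is a sum of at most \<open>h\<close> unit vectors, padded with copies of \<open>e\<^sub>0\<close>.

  A homomorphism \<open>f\<close> from \<open>\<int>\<^sup>n\<close> to a finite Abelian group \<open>H\<close> carries this sumset to the set of all
  \<open>h\<close>-fold sums of the elements \<open>f e\<^sub>0 = 0, f e\<^sub>1, \<dots>, f e\<^sub>n\<close>, so these elements form an \<open>h\<close>-basis iff
  \<open>f\<close> maps the simplex onto \<open>H\<close> (\<open>h_basis_hom_image_iff\<close>). On the other hand, for a surjective \<open>f\<close>
  the translates of a set \<open>S\<close> by the kernel cover \<open>\<int>\<^sup>n\<close> iff \<open>S\<close> meets every fibre of \<open>f\<close>, that is,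
  iff \<open>f\<close> maps \<open>S\<close> onto \<open>H\<close> (\<open>kernel_translates_cover_iff\<close>). Hence being a basis and giving a
  covering are the same property of \<open>f\<close>.

  Both halves of the theorem are instances. For the first, \<open>f\<close> sends \<open>x\<close> to \<open>\<Sum>\<^sub>i x\<^sub>i c\<^sub>i\<close>; its kernel is
  the relation lattice, which has full rank because it contains \<open>|G| e\<^sub>i\<close> for all \<open>i\<close>, and the
  isomorphism is the first isomorphism theorem. For the second, \<open>f\<close> is the projection of \<open>\<int>\<^sup>n\<close>
  onto \<open>\<int>\<^sup>n/L'\<close>; the quotient is finite since the finite simplex is mapped onto it.
\<close>

section \<open>The group of integer vectors\<close>

lemma carrier_Zn: "carrier (Zn n) = (\<Pi>\<^sub>E i\<in>{1..n}. UNIV)"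
  by (simp add: Zn_def)

lemma mult_Zn: "x \<otimes>\<^bsub>Zn n\<^esub> y = (\<lambda>i\<in>{1..n}. x i + y i)"
  by (simp add: Zn_def)

lemma one_Zn: "\<one>\<^bsub>Zn n\<^esub> = (\<lambda>i\<in>{1..n}. 0)"
  by (simp add: Zn_def)

lemma comm_group_Zn: "comm_group (Zn n)"
proof (rule group.group_comm_groupI)
  show "group (Zn n)"
    by (simp add: Zn_def)
qed (auto simp: mult_Zn add.commute)

definition axis_vector :: "nat \<Rightarrow> nat \<Rightarrow> int \<Rightarrow> nat \<Rightarrow> int" where
  "axis_vector n k a = (\<lambda>i\<in>{1..n}. if i = k then a else 0)"

lemma axis_vector_in_Zn: "axis_vector n k a \<in> carrier (Zn n)"
  by (simp add: axis_vector_def carrier_Zn)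

section \<open>The simplex as an iterated sumset\<close>

lemma discrete_simplex_subset: "discrete_simplex n h \<subseteq> carrier (Zn n)"
  by (auto simp: discrete_simplex_def)

lemma finite_discrete_simplex: "finite (discrete_simplex n h)"
proof (rule finite_subset)
  show "discrete_simplex n h \<subseteq> (\<Pi>\<^sub>E i\<in>{1..n}. {0..int h})"
  proof
    fix x assume x: "x \<in> discrete_simplex n h"
    have "x i \<le> int h" if "i \<in> {1..n}" for i
    proof -
      have "x i \<le> (\<Sum>i=1..n. x i)"
        using x that by (intro member_le_sum) (auto simp: discrete_simplex_def)
      then show ?thesis
        using x by (simp add: discrete_simplex_def)
    qed
    then show "x \<in> (\<Pi>\<^sub>E i\<in>{1..n}. {0..int h})"
      using x by (auto simp: discrete_simplex_def carrier_Zn PiE_iff)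
  qed
qed (simp add: finite_PiE)

lemma discrete_simplex_0: "discrete_simplex n 0 = {\<one>\<^bsub>Zn n\<^esub>}"
proof
  show "discrete_simplex n 0 \<subseteq> {\<one>\<^bsub>Zn n\<^esub>}"
  proof
    fix x assume x: "x \<in> discrete_simplex n 0"
    then have nonneg: "\<And>i. i \<in> {1..n} \<Longrightarrow> 0 \<le> x i" and "(\<Sum>i=1..n. x i) \<le> 0"
      by (auto simp: discrete_simplex_def)
    then have "(\<Sum>i=1..n. x i) = 0"
      by (meson order_antisym sum_nonneg)
    then have "\<forall>i\<in>{1..n}. x i = 0"
      using nonneg by (subst (asm) sum_nonneg_eq_0_iff) auto
    then show "x \<in> {\<one>\<^bsub>Zn n\<^esub>}"
      using x by (auto simp: discrete_simplex_def carrier_Zn one_Zn PiE_iff extensional_def fun_eq_iff)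
  qed
qed (auto simp: discrete_simplex_def carrier_Zn one_Zn)

text \<open>
  The index \<open>k = 0\<close> lies outside \<open>{1..n}\<close>, so \<open>axis_vector n 0 1\<close> is the zero vector. This makes
  adding a unit vector and leaving the vector alone instances of one operation. A vector of the
  larger simplex that is not in the smaller one has positive coordinate sum, so a unit vector can
  be subtracted from it.
\<close>

lemma discrete_simplex_Suc:
  "discrete_simplex n (Suc h) =
     {y \<otimes>\<^bsub>Zn n\<^esub> axis_vector n k 1 |y k. y \<in> discrete_simplex n h \<and> k \<in> {0..n}}"
  (is "?S = ?T")
proof
  show "?S \<subseteq> ?T"
  proof
    fix x assume x: "x \<in> ?S"
    then have nonneg: "\<And>i. i \<in> {1..n} \<Longrightarrow> 0 \<le> x i" and total: "(\<Sum>i=1..n. x i) \<le> int (Suc h)"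
      by (auto simp: discrete_simplex_def)
    have ext: "x \<in> extensional {1..n}"
      using x by (simp add: discrete_simplex_def carrier_Zn PiE_iff)
    show "x \<in> ?T"
    proof (cases "(\<Sum>i=1..n. x i) \<le> int h")
      case True
      then have "x \<in> discrete_simplex n h"
        using x by (simp add: discrete_simplex_def)
      moreover have "x = x \<otimes>\<^bsub>Zn n\<^esub> axis_vector n 0 1"
        using ext by (auto simp: mult_Zn axis_vector_def extensional_def fun_eq_iff)
      ultimately show ?thesis
        by fastforce
    next
      case False
      then obtain k where k: "k \<in> {1..n}" "x k > 0"
        by (metis (no_types, lifting) linorder_not_le of_nat_0_le_iff order_trans sum_nonpos)
      define y where "y = x(k := x k - 1)"
      have "(\<Sum>i=1..n. y i) = (\<Sum>i=1..n. x i) - 1"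
        using k by (simp add: y_def sum.remove[of _ k])
      then have "y \<in> discrete_simplex n h"
        using total nonneg k ext
        by (auto simp: discrete_simplex_def carrier_Zn PiE_iff extensional_def y_def)
      moreover have "x = y \<otimes>\<^bsub>Zn n\<^esub> axis_vector n k 1"
        using ext k by (auto simp: mult_Zn axis_vector_def extensional_def fun_eq_iff y_def)
      moreover have "k \<in> {0..n}"
        using k by simp
      ultimately show ?thesis
        by blast
    qed
  qed
  show "?T \<subseteq> ?S"
  proof clarify
    fix y k assume y: "y \<in> discrete_simplex n h"
    have "(\<Sum>i=1..n. if i = k then 1 else 0) \<le> (1::int)"
      by simp
    then have "(\<Sum>i=1..n. y i + (if i = k then 1 else 0)) \<le> int (Suc h)"
      using y unfolding sum.distrib discrete_simplex_def by simp
    then show "y \<otimes>\<^bsub>Zn n\<^esub> axis_vector n k 1 \<in> ?S"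
      using y by (auto simp: discrete_simplex_def carrier_Zn mult_Zn axis_vector_def)
  qed
qed

lemma discrete_simplex_eq_sumset:
  "discrete_simplex n h =
     (\<lambda>i. \<Otimes>\<^bsub>Zn n\<^esub>j\<in>{1..h}. axis_vector n (i j) 1) ` ({1..h} \<rightarrow> {0..n})"
proof (induction h)
  case 0
  interpret Z: comm_group "Zn n" by (rule comm_group_Zn)
  show ?case
    by (simp add: discrete_simplex_0)
next
  case (Suc h)
  interpret Z: comm_group "Zn n" by (rule comm_group_Zn)
  let ?e = "\<lambda>k. axis_vector n k 1"
  have split: "(\<Otimes>\<^bsub>Zn n\<^esub>j\<in>{1..Suc h}. ?e (i j)) =
      (\<Otimes>\<^bsub>Zn n\<^esub>j\<in>{1..h}. ?e (i j)) \<otimes>\<^bsub>Zn n\<^esub> ?e (i (Suc h))" for i :: "nat \<Rightarrow> nat"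
    by (simp add: atLeastAtMostSuc_conv Z.m_comm axis_vector_in_Zn)
  show ?case
  proof (intro subset_antisym subsetI)
    fix x assume "x \<in> discrete_simplex n (Suc h)"
    then obtain y k where y: "y \<in> discrete_simplex n h" and k: "k \<in> {0..n}"
      and x: "x = y \<otimes>\<^bsub>Zn n\<^esub> ?e k"
      unfolding discrete_simplex_Suc by (elim CollectE exE conjE)
    obtain i where i: "i \<in> {1..h} \<rightarrow> {0..n}" and y: "y = (\<Otimes>\<^bsub>Zn n\<^esub>j\<in>{1..h}. ?e (i j))"
      using y unfolding Suc by (rule imageE)
    let ?i = "i(Suc h := k)"
    have "(\<Otimes>\<^bsub>Zn n\<^esub>j\<in>{1..h}. ?e (?i j)) = y"
      unfolding y by (rule Z.finprod_cong') (simp_all add: axis_vector_in_Zn)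
    then have "x = (\<Otimes>\<^bsub>Zn n\<^esub>j\<in>{1..Suc h}. ?e (?i j))"
      unfolding split x by simp
    moreover have "?i \<in> {1..Suc h} \<rightarrow> {0..n}"
      using i k by (auto simp: Pi_iff le_Suc_eq)
    ultimately show "x \<in> (\<lambda>i. \<Otimes>\<^bsub>Zn n\<^esub>j\<in>{1..Suc h}. ?e (i j)) ` ({1..Suc h} \<rightarrow> {0..n})"
      by (rule image_eqI)
  next
    fix x assume "x \<in> (\<lambda>i. \<Otimes>\<^bsub>Zn n\<^esub>j\<in>{1..Suc h}. ?e (i j)) ` ({1..Suc h} \<rightarrow> {0..n})"
    then obtain i where i: "i \<in> {1..Suc h} \<rightarrow> {0..n}"
      and x: "x = (\<Otimes>\<^bsub>Zn n\<^esub>j\<in>{1..h}. ?e (i j)) \<otimes>\<^bsub>Zn n\<^esub> ?e (i (Suc h))"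
      unfolding split by (rule imageE)
    have "i \<in> {1..h} \<rightarrow> {0..n}" "i (Suc h) \<in> {0..n}"
      using i by (simp_all add: Pi_iff)
    moreover from this(1) have "(\<Otimes>\<^bsub>Zn n\<^esub>j\<in>{1..h}. ?e (i j)) \<in> discrete_simplex n h"
      unfolding Suc by (rule imageI)
    ultimately show "x \<in> discrete_simplex n (Suc h)"
      unfolding discrete_simplex_Suc x by (intro CollectI exI conjI) (rule refl)
  qed
qed

section \<open>Bases and homomorphisms from the vector group\<close>

lemma hom_finprod:
  assumes "comm_group G" "comm_group H" "f \<in> hom G H" "x \<in> A \<rightarrow> carrier G"
  shows "f (\<Otimes>\<^bsub>G\<^esub>a\<in>A. x a) = (\<Otimes>\<^bsub>H\<^esub>a\<in>A. f (x a))"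
proof -
  interpret G: comm_group G by fact
  interpret H: comm_group H by fact
  interpret group_hom G H f
    by unfold_locales fact
  show ?thesis
    using \<open>x \<in> A \<rightarrow> carrier G\<close>
  proof (induction A rule: infinite_finite_induct)
    case (insert a A)
    then have "x \<in> A \<rightarrow> carrier G" "x a \<in> carrier G"
      by auto
    moreover from this have "(\<lambda>b. f (x b)) \<in> A \<rightarrow> carrier H"
      by (auto simp: Pi_iff)
    ultimately show ?case
      using insert by simp
  qed simp_all
qed

text \<open>
  Bases are defined with nondecreasing index sequences, sumsets with arbitrary ones. In a commutative
  group a sum does not change when its terms are permuted, so it suffices to sort the indices.
\<close>

lemma exists_mono_rearrangement:
  fixes i :: "nat \<Rightarrow> nat"
  obtains p where "bij_betw p {1..h} {1..h}" "mono_on {1..h} (\<lambda>j. i (p j))"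
proof -
  define xs where "xs = map i [1..<Suc h]"
  have len: "length xs = h"
    by (simp add: xs_def)
  obtain q where q: "q permutes {..<h}" and perm: "permute_list q xs = sort xs"
    using mset_eq_permutation[of "sort xs" xs] len by auto
  \<comment> \<open>The shifts by one translate between list positions \<open>0..h-1\<close> and the index range \<open>1..h\<close>.\<close>
  define p where "p = Suc \<circ> q \<circ> (\<lambda>j. j - 1)"
  have "bij_betw (\<lambda>j. j - 1) {1..h} {..<h}"
    by (rule bij_betw_byWitness[where f' = Suc]) auto
  moreover have "bij_betw q {..<h} {..<h}"
    using q by (rule permutes_imp_bij)
  moreover have "bij_betw Suc {..<h} {1..h}"
    by (rule bij_betw_byWitness[where f' = "\<lambda>j. j - 1"]) auto
  ultimately have "bij_betw p {1..h} {1..h}"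
    unfolding p_def by (meson bij_betw_trans)
  moreover have "mono_on {1..h} (\<lambda>j. i (p j))"
  proof (rule mono_onI)
    have val: "i (p j) = sort xs ! (j - 1)" if "j \<in> {1..h}" for j
    proof -
      have "j - 1 < h" "q (j - 1) < h"
        using that permutes_in_image[OF q, of "j - 1"] by auto
      then show ?thesis
        using q by (simp add: perm[symmetric] permute_list_nth len p_def) (simp add: xs_def del: upt_Suc)
    qed
    fix r s assume "r \<in> {1..h}" "s \<in> {1..h}" "r \<le> s"
    then show "i (p r) \<le> i (p s)"
      by (auto simp: val len intro!: sorted_nth_mono)
  qed
  ultimately show thesis
    by (rule that)
qed

text \<open>
  The simplex is the \<open>h\<close>-fold sumset of the zero vector and the unit vectors, and \<open>f\<close> maps it onto the
  \<open>h\<close>-fold sumset of their images.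
\<close>

lemma h_basis_hom_image_iff:
  assumes H: "comm_group H" and fin: "finite (carrier H)" and f: "f \<in> hom (Zn n) H"
  shows "h_basis H h ((\<lambda>k. f (axis_vector n k 1)) ` {0..n}) \<longleftrightarrow>
           f ` discrete_simplex n h = carrier H"
proof -
  interpret H: comm_group H by fact
  define e where "e k = f (axis_vector n k 1)" for k
  have e: "e k \<in> carrier H" for k
    using f axis_vector_in_Zn by (auto simp: e_def hom_def)
  have image: "f ` discrete_simplex n h =
      (\<lambda>i. \<Otimes>\<^bsub>H\<^esub>j\<in>{1..h}. e (i j)) ` ({1..h} \<rightarrow> {0..n})"
  proof -
    have "f (\<Otimes>\<^bsub>Zn n\<^esub>j\<in>{1..h}. axis_vector n (i j) 1) = (\<Otimes>\<^bsub>H\<^esub>j\<in>{1..h}. e (i j))" for i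
      unfolding e_def by (rule hom_finprod[OF comm_group_Zn H f]) (simp add: axis_vector_in_Zn)
    then show ?thesis
      by (simp only: discrete_simplex_eq_sumset image_image)
  qed
  have "h_basis H h (e ` {0..n}) \<longleftrightarrow> f ` discrete_simplex n h = carrier H"
  proof
    assume "h_basis H h (e ` {0..n})"
    then obtain m :: nat and c where C: "e ` {0..n} = c ` {0..m}"
      and basis: "\<forall>g\<in>carrier H. \<exists>i. i \<in> {1..h} \<rightarrow> {0..m} \<and> mono_on {1..h} i \<and>
        g = (\<Otimes>\<^bsub>H\<^esub>j\<in>{1..h}. c (i j))"
      unfolding h_basis_def by (elim conjE exE) (rule that, assumption+)
    \<comment> \<open>The basis property speaks of some enumeration \<open>c\<close> of the set; \<open>t\<close> translates it into \<open>e\<close>.\<close>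
    have "\<forall>k\<in>{0..m}. \<exists>l\<in>{0..n}. c k = e l"
      using C by blast
    then obtain t where t: "\<And>k. k \<in> {0..m} \<Longrightarrow> t k \<in> {0..n} \<and> c k = e (t k)"
      by metis
    have "g \<in> f ` discrete_simplex n h" if "g \<in> carrier H" for g
    proof -
      obtain i where i: "i \<in> {1..h} \<rightarrow> {0..m}" and g: "g = (\<Otimes>\<^bsub>H\<^esub>j\<in>{1..h}. c (i j))"
        using bspec[OF basis \<open>g \<in> carrier H\<close>] by blast
      have "g = (\<Otimes>\<^bsub>H\<^esub>j\<in>{1..h}. e (t (i j)))"
        unfolding g using i t by (intro H.finprod_cong') (auto simp: e Pi_iff)
      moreover have "(\<lambda>j. t (i j)) \<in> {1..h} \<rightarrow> {0..n}"
        using i t by (auto simp: Pi_iff)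
      ultimately show ?thesis
        unfolding image by (rule image_eqI)
    qed
    moreover have "f ` discrete_simplex n h \<subseteq> carrier H"
      using hom_in_carrier[OF f] discrete_simplex_subset[of n h] by auto
    ultimately show "f ` discrete_simplex n h = carrier H"
      by (intro subset_antisym subsetI) auto
  next
    assume onto: "f ` discrete_simplex n h = carrier H"
    have "\<exists>i. i \<in> {1..h} \<rightarrow> {0..n} \<and> mono_on {1..h} i \<and> g = (\<Otimes>\<^bsub>H\<^esub>j\<in>{1..h}. e (i j))"
      if "g \<in> carrier H" for g
    proof -
      obtain i where i: "i \<in> {1..h} \<rightarrow> {0..n}" and g: "g = (\<Otimes>\<^bsub>H\<^esub>j\<in>{1..h}. e (i j))"
        using \<open>g \<in> carrier H\<close> unfolding onto[symmetric] image by (rule imageE)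
      obtain p where p: "bij_betw p {1..h} {1..h}" and mono: "mono_on {1..h} (\<lambda>j. i (p j))"
        by (rule exists_mono_rearrangement)
      have "g = (\<Otimes>\<^bsub>H\<^esub>j\<in>{1..h}. e (i (p j)))"
        using H.finprod_reindex[of "\<lambda>j. e (i j)" p "{1..h}"] p e
        by (simp add: g bij_betw_def)
      moreover have "(\<lambda>j. i (p j)) \<in> {1..h} \<rightarrow> {0..n}"
        using i bij_betwE[OF p] by (auto simp: Pi_iff)
      ultimately show ?thesis
        using mono by (intro exI[of _ "\<lambda>j. i (p j)"] conjI)
    qed
    then show "h_basis H h (e ` {0..n})"
      unfolding h_basis_def using H fin e by (intro conjI exI[of _ n] exI[of _ e]) auto
  qed
  then show ?thesis
    by (simp add: e_def)
qed

text \<open>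
  The translates of \<open>S\<close> by the kernel contain \<open>y\<close> iff some \<open>s\<close> in \<open>S\<close> differs from \<open>y\<close> by a kernel element,
  that is, iff \<open>h s = h y\<close>.
\<close>

lemma (in group_hom) kernel_translates_cover_iff:
  assumes S: "S \<subseteq> carrier G" and onto: "h ` carrier G = carrier H"
  shows "(\<Union>x\<in>kernel G H h. S #> x) = carrier G \<longleftrightarrow> h ` S = carrier H"
proof
  assume cover: "(\<Union>x\<in>kernel G H h. S #> x) = carrier G"
  have "h y \<in> h ` S" if y: "y \<in> carrier G" for y
  proof -
    have "y \<in> (\<Union>x\<in>kernel G H h. S #> x)"
      using cover y by simp
    then obtain s x where s: "s \<in> S" and "x \<in> kernel G H h" "y = s \<otimes> x"
      by (auto simp: r_coset_def)
    then have "h y = h s"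
      using subsetD[OF S s] by (simp add: kernel_def)
    then show ?thesis
      using s by (rule image_eqI)
  qed
  then have "h ` carrier G \<subseteq> h ` S"
    by (rule image_subsetI)
  then show "h ` S = carrier H"
    using image_mono[OF S, of h] onto by simp
next
  assume image: "h ` S = carrier H"
  have "y \<in> (\<Union>x\<in>kernel G H h. S #> x)" if y: "y \<in> carrier G" for y
  proof -
    have "h y \<in> h ` S"
      using image y by simp
    then obtain s where s: "s \<in> S" "h y = h s"
      by (elim imageE)
    then have sG: "s \<in> carrier G"
      using S by auto
    have "inv s \<otimes> y \<in> kernel G H h"
      using s sG y by (simp add: kernel_def)
    moreover have "y \<in> S #> (inv s \<otimes> y)"
    proof -
      have "s \<otimes> (inv s \<otimes> y) \<in> S #> (inv s \<otimes> y)"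
        using s(1) by (auto simp: r_coset_def)
      then show ?thesis
        using sG y by (simp add: G.m_assoc[symmetric])
    qed
    ultimately show ?thesis
      by (rule UN_I)
  qed
  moreover have "S #> x \<subseteq> carrier G" if "x \<in> kernel G H h" for x
    using S that by (auto simp: kernel_def r_coset_def)
  ultimately show "(\<Union>x\<in>kernel G H h. S #> x) = carrier G"
    by (intro subset_antisym UN_least) auto
qed

section \<open>Evaluation at group elements and the relation lattice\<close>

definition eval_at :: "('a, 'b) monoid_scheme \<Rightarrow> nat \<Rightarrow> (nat \<Rightarrow> 'a) \<Rightarrow> (nat \<Rightarrow> int) \<Rightarrow> 'a" where
  "eval_at G n c x = (\<Otimes>\<^bsub>G\<^esub>i\<in>{1..n}. c i [^]\<^bsub>G\<^esub> x i)"

lemma relation_lattice_eq_kernel: "relation_lattice G n c = kernel (Zn n) G (eval_at G n c)"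
  by (auto simp: relation_lattice_def kernel_def eval_at_def)

context comm_group
begin

lemma eval_at_hom:
  assumes c: "c \<in> {1..n} \<rightarrow> carrier G"
  shows "eval_at G n c \<in> hom (Zn n) G"
proof (rule homI)
  fix x y
  have "(\<Otimes>i\<in>{1..n}. c i [^] (x \<otimes>\<^bsub>Zn n\<^esub> y) i) = (\<Otimes>i\<in>{1..n}. c i [^] x i \<otimes> c i [^] y i)"
    using c by (intro finprod_cong') (auto simp: mult_Zn int_pow_mult Pi_iff)
  then show "eval_at G n c (x \<otimes>\<^bsub>Zn n\<^esub> y) = eval_at G n c x \<otimes> eval_at G n c y"
    using c by (subst (asm) finprod_multf) (auto simp: eval_at_def Pi_iff)
qed (use c in \<open>auto simp: eval_at_def Pi_iff intro!: finprod_closed\<close>)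

lemma eval_at_axis_vector:
  assumes c: "c \<in> {1..n} \<rightarrow> carrier G" and k: "k \<in> {1..n}"
  shows "eval_at G n c (axis_vector n k a) = c k [^] a"
proof -
  have "eval_at G n c (axis_vector n k a) = (\<Otimes>i\<in>{1..n}. if k = i then c i [^] a else \<one>)"
    unfolding eval_at_def using c by (intro finprod_cong') (auto simp: axis_vector_def Pi_iff)
  also have "\<dots> = c k [^] a"
    using c k by (intro finprod_singleton) (auto simp: Pi_iff)
  finally show ?thesis .
qed

lemma eval_at_axis_vector_0: "eval_at G n c (axis_vector n 0 a) = \<one>"
  unfolding eval_at_def by (rule finprod_one_eqI) (auto simp: axis_vector_def)

text \<open>
  The order \<open>N\<close> of the group annihilates every element, so the vectors \<open>N e\<^sub>j\<close> are relations; they are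
  independent because \<open>N > 0\<close>.
\<close>

lemma full_rank_relation_lattice:
  assumes c: "c \<in> {1..n} \<rightarrow> carrier G" and fin: "finite (carrier G)"
  shows "full_rank_sublattice n (relation_lattice G n c)"
proof -
  interpret Z: comm_group "Zn n" by (rule comm_group_Zn)
  interpret group_hom "Zn n" G "eval_at G n c"
    by unfold_locales (rule eval_at_hom[OF c])
  define N where "N = int (order G)"
  have "N > 0"
    using fin by (simp add: N_def order_gt_0_iff_finite)
  have "axis_vector n j N \<in> relation_lattice G n c" if "j \<in> {1..n}" for j
    using c that
    by (auto simp: relation_lattice_eq_kernel kernel_def axis_vector_in_Zn eval_at_axis_vector
        N_def int_pow_int pow_order_eq_1 Pi_iff)
  moreover have "a i = 0"
    if zero: "\<forall>i\<in>{1..n}. (\<Sum>j=1..n. a j * axis_vector n j N i) = 0" and i: "i \<in> {1..n}" for a i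
  proof -
    have "(\<Sum>j=1..n. a j * axis_vector n j N i) = (\<Sum>j=1..n. if i = j then a j * N else 0)"
      using i by (intro sum.cong) (auto simp: axis_vector_def)
    then have "a i * N = 0"
      using zero i by simp
    then show ?thesis
      using \<open>N > 0\<close> by simp
  qed
  ultimately show ?thesis
    using subgroup_kernel unfolding full_rank_sublattice_def relation_lattice_eq_kernel[symmetric]
    by (intro conjI exI[of _ "\<lambda>j. axis_vector n j N"]) auto
qed

text \<open>
  The given basis consists of the values of the evaluation homomorphism at the zero vector and at the
  unit vectors, so that homomorphism already maps the simplex onto the group. The covering and the
  isomorphism both follow from this surjectivity.
\<close>

lemma relation_lattice_covering:
  assumes basis: "h_basis G h (insert \<one> (c ` {1..n}))"
  shows "lattice_covering n (discrete_simplex n h) (relation_lattice G n c)"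
    and "G \<cong> Zn n Mod relation_lattice G n c"
proof -
  interpret Z: comm_group "Zn n" by (rule comm_group_Zn)
  have c: "c \<in> {1..n} \<rightarrow> carrier G" and fin: "finite (carrier G)"
    using basis by (auto simp: h_basis_def)
  interpret group_hom "Zn n" G "eval_at G n c"
    by unfold_locales (rule eval_at_hom[OF c])
  have "(\<lambda>k. eval_at G n c (axis_vector n k 1)) ` {0..n} = insert \<one> (c ` {1..n})"
  proof -
    have "{0..n} = insert 0 {1..n}"
      by auto
    moreover have "eval_at G n c (axis_vector n k 1) = c k" if "k \<in> {1..n}" for k
      using that c by (subst eval_at_axis_vector) (auto simp: Pi_iff)
    ultimately show ?thesis
      by (simp add: eval_at_axis_vector_0)
  qed
  then have onto_S: "eval_at G n c ` discrete_simplex n h = carrier G"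
    using h_basis_hom_image_iff[OF comm_group_axioms fin homh] basis by simp
  then have onto: "eval_at G n c ` carrier (Zn n) = carrier G"
    using discrete_simplex_subset[of n h] by fastforce
  show "lattice_covering n (discrete_simplex n h) (relation_lattice G n c)"
    unfolding lattice_covering_def
    using finite_discrete_simplex discrete_simplex_subset full_rank_relation_lattice[OF c fin]
      kernel_translates_cover_iff[OF discrete_simplex_subset onto] onto_S
    by (simp add: relation_lattice_eq_kernel)
  have "Zn n Mod relation_lattice G n c \<cong> G"
    unfolding relation_lattice_eq_kernel by (rule FactGroup_iso[OF onto])
  then show "G \<cong> Zn n Mod relation_lattice G n c"
    using normal.factorgroup_is_group[OF normal_kernel]
    by (simp add: group.iso_sym relation_lattice_eq_kernel)
qed

end

section \<open>The quotient by a covering lattice\<close>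

text \<open>
  The basis consists of the cosets of the zero vector and of the unit vectors. Some of these cosets
  may coincide, hence only an upper bound on the cardinality.
\<close>

lemma quotient_of_covering_has_basis:
  assumes cover: "lattice_covering n (discrete_simplex n h) L"
  shows "\<exists>C. h_basis (Zn n Mod L) h C \<and> card C \<le> n + 1"
proof -
  interpret Z: comm_group "Zn n" by (rule comm_group_Zn)
  let ?Q = "Zn n Mod L" and ?\<pi> = "\<lambda>x. L #>\<^bsub>Zn n\<^esub> x"
  have L: "subgroup L (Zn n)"
    and union: "(\<Union>x\<in>L. discrete_simplex n h #>\<^bsub>Zn n\<^esub> x) = carrier (Zn n)"
    using cover by (simp_all add: lattice_covering_def full_rank_sublattice_def)
  have Q: "comm_group ?Q"
    using L by (rule Z.abelian_FactGroup)
  interpret Q: comm_group ?Q by (rule Q)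
  have \<pi>: "?\<pi> \<in> hom (Zn n) ?Q"
    using Z.subgroup_imp_normal[OF L] by (rule normal.r_coset_hom_Mod)
  interpret group_hom "Zn n" ?Q ?\<pi>
    by unfold_locales (rule \<pi>)
  have "?\<pi> x = L \<longleftrightarrow> x \<in> L" if "x \<in> carrier (Zn n)" for x
    using that L Z.coset_join1 Z.coset_join2 by metis
  then have "kernel (Zn n) ?Q ?\<pi> = L"
    using subgroup.subset[OF L] by (auto simp: kernel_def)
  then have onto_S: "?\<pi> ` discrete_simplex n h = carrier ?Q"
    using kernel_translates_cover_iff[OF discrete_simplex_subset carrier_FactGroup[symmetric]] union
    by simp
  then have "finite (carrier ?Q)"
    using finite_discrete_simplex by (metis finite_imageI)
  then have "h_basis ?Q h ((\<lambda>k. ?\<pi> (axis_vector n k 1)) ` {0..n})"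
    using h_basis_hom_image_iff[OF Q _ \<pi>] onto_S by simp
  moreover have "card ((\<lambda>k. ?\<pi> (axis_vector n k 1)) ` {0..n}) \<le> n + 1"
    using card_image_le[of "{0..n}" "\<lambda>k. ?\<pi> (axis_vector n k 1)"] by simp
  ultimately show ?thesis
    by (intro exI conjI)
qed

theorem theorem3p1:
  fixes h n :: nat
    and G :: "('a, 'b) monoid_scheme"
  assumes "h \<ge> 1" and "n \<ge> 1"
  shows "(\<forall>c :: nat \<Rightarrow> 'a.
            comm_group G \<and> finite (carrier G) \<and> h_basis G h (insert \<one>\<^bsub>G\<^esub> (c ` {1..n})) \<longrightarrow>
              lattice_covering n (discrete_simplex n h) (relation_lattice G n c) \<and>
              G \<cong> Zn n Mod relation_lattice G n c) \<and>
         (\<forall>L'. lattice_covering n (discrete_simplex n h) L' \<longrightarrow>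
            (\<exists>C. h_basis (Zn n Mod L') h C \<and> card C \<le> n + 1))"
proof (intro conjI allI impI)
  fix c :: "nat \<Rightarrow> 'a"
  assume c: "comm_group G \<and> finite (carrier G) \<and> h_basis G h (insert \<one>\<^bsub>G\<^esub> (c ` {1..n}))"
  show "lattice_covering n (discrete_simplex n h) (relation_lattice G n c)"
    using c by (intro comm_group.relation_lattice_covering(1)) simp_all
  show "G \<cong> Zn n Mod relation_lattice G n c"
    using c by (intro comm_group.relation_lattice_covering(2)[where h = h]) simp_all
next
  fix L'
  assume "lattice_covering n (discrete_simplex n h) L'"
  then show "\<exists>C. h_basis (Zn n Mod L') h C \<and> card C \<le> n + 1"
    by (rule quotient_of_covering_has_basis)
qed

end
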